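(* Let $d\ge 1$, $n\ge 3$, $1<j<n$, and let $H$ be a self-transpose $d\times d$ Hadamard matrix. Applying the adjoint 2-qudit gates $Z_{j-1,j}^\dagger$ and $Z_{j,j+1}^\dagger$ to the $n$-partite cluster chain $|\mathrm{C}_n\rangle\in(\mathbb{C}^d)^{\otimes n}$ yields, up to a nonzero scalar factor, the state $$|\mathrm{C}_{j-1}\rangle\otimes\Big(\sum_{k=0}^{d-1}|k\rangle\Big)\otimes|\mathrm{C}_{n-j}\rangle ,$$ that is, the chain is cut into two separate cluster chains of total length $n-1$ and the target qudit $j$ is left in the (unnormalized) $|+\rangle$ state.
   Context: A Hadamard matrix here is a unitary matrix all of whose entries have the same absolute value; self-transpose means $H_{a,b}=H_{b,a}$. For $m\ge1$ the $m$-partite cluster chain associated to $H$ is $$|\mathrm{C}_m\rangle=\sum_{a_1,\dots,a_m=0}^{d-1}\overline{H}_{a_1,a_2}\cdots\overline{H}_{a_{m-1},a_m}\,|a_1\cdots a_m\rangle$$ (with $|\mathrm{C}_1\rangle=\sum_a|a\rangle$). The 2-qudit gate $Z_{i,j}$ acts on qudits $i,j$ as the diagonal unitary $|a\rangle_i|b\rangle_j\mapsto\sqrt d\,\overline{H}_{a,b}|a\rangle_i|b\rangle_j$ and as the identity on the other qudits; $Z_{i,j}^\dagger$ is its adjoint. *)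

theory Defs
  imports Complex_Main "Jordan_Normal_Form.Matrix" "Jordan_Normal_Form.Schur_Decomposition"
begin

definition unitary_mat :: "nat \<Rightarrow> complex mat \<Rightarrow> bool" where
  "unitary_mat d U \<longleftrightarrow> U \<in> carrier_mat d d
     \<and> U * mat_adjoint U = 1\<^sub>m d \<and> mat_adjoint U * U = 1\<^sub>m d"

definition hadamard_mat :: "nat \<Rightarrow> complex mat \<Rightarrow> bool" where
  "hadamard_mat d H \<longleftrightarrow> unitary_mat d H
     \<and> (\<forall>a<d. \<forall>b<d. \<forall>a'<d. \<forall>b'<d. cmod (H $$ (a, b)) = cmod (H $$ (a', b')))"

text \<open>
  The space of \<open>n\<close> qudits is the \<open>n\<close>-th tensor power of the \<open>d\<close>-dimensional complex vectors,
  realised as \<open>carrier_vec (d ^ n)\<close> through the Kronecker product; its basis vectors are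
  ordered lexicographically, the first tensor factor being the most significant one.
\<close>

definition tensor_vec :: "complex vec \<Rightarrow> complex vec \<Rightarrow> complex vec" (infixr "\<otimes>\<^sub>v" 75) where
  "u \<otimes>\<^sub>v v = vec (dim_vec u * dim_vec v) (\<lambda>x. u $ (x div dim_vec v) * v $ (x mod dim_vec v))"

text \<open>The basis vector written \<open>|a\<^sub>1 \<dots> a\<^sub>m\<rangle>\<close>, for the list \<open>[a\<^sub>1, \<dots>, a\<^sub>m]\<close> of labels below \<open>d\<close>.\<close>

fun ket :: "nat \<Rightarrow> nat list \<Rightarrow> complex vec" where
  "ket d [] = vec 1 (\<lambda>_. 1)"
| "ket d (a # as) = unit_vec d a \<otimes>\<^sub>v ket d as"

definition words :: "nat \<Rightarrow> nat \<Rightarrow> nat list set" where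
  "words d m = {as. length as = m \<and> set as \<subseteq> {..<d}}"

text \<open>List positions start at \<open>0\<close>, so \<open>as ! k\<close> is the label of qudit \<open>k + 1\<close>.\<close>

definition cluster_chain :: "nat \<Rightarrow> complex mat \<Rightarrow> nat \<Rightarrow> complex vec" where
  "cluster_chain d H m = finsum_vec TYPE(complex) (d ^ m)
     (\<lambda>as. (\<Prod>k<m - 1. cnj (H $$ (as ! k, as ! Suc k))) \<cdot>\<^sub>v ket d as) (words d m)"

text \<open>
  The label of qudit \<open>i\<close> (counted from \<open>1\<close>) in the basis vector with index \<open>x\<close>;
  see \<open>label_word_index\<close> and \<open>ket_eq_unit_vec\<close> below.
\<close>

definition label :: "nat \<Rightarrow> nat \<Rightarrow> nat \<Rightarrow> nat \<Rightarrow> nat" where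
  "label d n i x = x div d ^ (n - i) mod d"

text \<open>The action of the gate on basis vectors is \<open>gate_Z_ket\<close> below.\<close>

definition gate_Z :: "nat \<Rightarrow> complex mat \<Rightarrow> nat \<Rightarrow> nat \<Rightarrow> nat \<Rightarrow> complex mat" where
  "gate_Z d H n i j = mat_diag (d ^ n)
     (\<lambda>x. complex_of_real (sqrt (real d)) * cnj (H $$ (label d n i x, label d n j x)))"

definition ket_sum :: "nat \<Rightarrow> complex vec" where
  "ket_sum d = finsum_vec TYPE(complex) d (\<lambda>k. unit_vec d k) {..<d}"

fun word_index :: "nat \<Rightarrow> nat list \<Rightarrow> nat" where
  "word_index d [] = 0"
| "word_index d (a # as) = a * d ^ length as + word_index d as"

lemma word_index_less: "as \<in> words d m \<Longrightarrow> word_index d as < d ^ m"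
proof (induction as arbitrary: m)
  case Nil
  then show ?case by (simp add: words_def)
next
  case (Cons a as)
  then have a: "a < d" and m: "m = Suc (length as)" and as: "as \<in> words d (length as)"
    by (auto simp: words_def)
  have "word_index d (a # as) < Suc a * d ^ length as"
    using Cons.IH[OF as] by simp
  also have "\<dots> \<le> d * d ^ length as"
    using a by (intro mult_right_mono) auto
  finally show ?case by (simp add: m)
qed

lemma ket_eq_unit_vec: "as \<in> words d m \<Longrightarrow> ket d as = unit_vec (d ^ m) (word_index d as)"
proof (induction as arbitrary: m)
  case Nil
  then show ?case by (auto simp: words_def unit_vec_def)
next
  case (Cons a as)
  then have a: "a < d" and m: "m = Suc (length as)" and as: "as \<in> words d (length as)"
    by (auto simp: words_def)
  let ?D = "d ^ length as"
  have less: "word_index d as < ?D"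
    using word_index_less[OF as] .
  have D: "dim_vec (ket d as) = ?D"
    by (simp add: Cons.IH[OF as])
  have eq: "x = a * ?D + word_index d as \<longleftrightarrow> x div ?D = a \<and> x mod ?D = word_index d as" for x
  proof
    assume "x = a * ?D + word_index d as"
    then show "x div ?D = a \<and> x mod ?D = word_index d as"
      using a less by simp
  next
    assume "x div ?D = a \<and> x mod ?D = word_index d as"
    then show "x = a * ?D + word_index d as"
      using div_mult_mod_eq[of x ?D] by metis
  qed
  show ?case
  proof (rule eq_vecI)
    fix x
    assume "x < dim_vec (unit_vec (d ^ m) (word_index d (a # as)))"
    then have x: "x < d * ?D"
      by (simp add: m)
    then have "x div ?D < d" "x mod ?D < ?D"
      using a by (simp_all add: less_mult_imp_div_less)
    then have "ket d (a # as) $ x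
        = (if x div ?D = a then 1 else 0) * (if x mod ?D = word_index d as then 1 else 0)"
      using x by (simp add: tensor_vec_def Cons.IH[OF as] unit_vec_def)
    also have "\<dots> = (if x = a * ?D + word_index d as then 1 else 0)"
      unfolding eq by simp
    also have "\<dots> = unit_vec (d ^ m) (word_index d (a # as)) $ x"
      using x by (simp add: m unit_vec_def)
    finally show "ket d (a # as) $ x = unit_vec (d ^ m) (word_index d (a # as)) $ x" .
  qed (simp add: m tensor_vec_def D)
qed

lemma label_word_index:
  assumes "as \<in> words d n" "1 \<le> i" "i \<le> n"
  shows "label d n i (word_index d as) = as ! (i - 1)"
  using assms
proof (induction as arbitrary: n i)
  case Nil
  then show ?case by (simp add: words_def)
next
  case (Cons a as)
  then have a: "a < d" and n: "n = Suc (length as)" and as: "as \<in> words d (length as)"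
    by (auto simp: words_def)
  have less: "word_index d as < d ^ length as"
    using word_index_less[OF as] .
  show ?case
  proof (cases "i = 1")
    case True
    then show ?thesis using a less by (simp add: n label_def)
  next
    case False
    then obtain k where k: "i = Suc (Suc k)"
      using Cons.prems(2) by (metis One_nat_def not0_implies_Suc not_one_le_zero)
    let ?e = "length as - Suc k"
    have e: "length as = Suc k + ?e"
      using Cons.prems(3) k n by simp
    have "d ^ length as = d ^ Suc k * d ^ ?e"
      using e by (metis power_add)
    then have "word_index d (a # as) = word_index d as + (a * d ^ k * d) * d ^ ?e"
      by (simp add: mult_ac)
    moreover have "d ^ ?e \<noteq> 0"
      using a by simp
    ultimately have "word_index d (a # as) div d ^ ?e
        = a * d ^ k * d + word_index d as div d ^ ?e"
      using div_mult_self1 by metis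
    then have "label d n i (word_index d (a # as)) = label d (length as) (Suc k) (word_index d as)"
      by (simp add: label_def n k)
    also have "\<dots> = as ! k"
      using Cons.IH[OF as, of "Suc k"] e by simp
    finally show ?thesis by (simp add: k)
  qed
qed

lemma gate_Z_ket:
  assumes "as \<in> words d n" "1 \<le> i" "i \<le> n" "1 \<le> j" "j \<le> n"
  shows "gate_Z d H n i j *\<^sub>v ket d as
    = (complex_of_real (sqrt (real d)) * cnj (H $$ (as ! (i - 1), as ! (j - 1)))) \<cdot>\<^sub>v ket d as"
proof (rule eq_vecI)
  let ?w = "word_index d as"
  note w = word_index_less[OF assms(1)]
  fix x
  assume "x < dim_vec ((complex_of_real (sqrt (real d)) *
    cnj (H $$ (as ! (i - 1), as ! (j - 1)))) \<cdot>\<^sub>v ket d as)"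
  then have x: "x < d ^ n"
    by (simp add: ket_eq_unit_vec[OF assms(1)])
  have "(gate_Z d H n i j *\<^sub>v ket d as) $ x = gate_Z d H n i j $$ (x, ?w)"
    using x w by (simp add: ket_eq_unit_vec[OF assms(1)] gate_Z_def mat_diag_def)
  then show "(gate_Z d H n i j *\<^sub>v ket d as) $ x = ((complex_of_real (sqrt (real d)) *
    cnj (H $$ (as ! (i - 1), as ! (j - 1)))) \<cdot>\<^sub>v ket d as) $ x"
    using x w label_word_index[OF assms(1)] assms
    by (simp add: ket_eq_unit_vec[OF assms(1)] gate_Z_def mat_diag_def unit_vec_def)
qed (simp add: ket_eq_unit_vec[OF assms(1)] gate_Z_def mat_diag_def)

end

theory Submission
  imports Defs
begin

text \<open>
  Every gate is diagonal in the computational basis, so it suffices to compare amplitudes word by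
  word. The amplitude of a chain is a product over neighbouring letters, and cutting a word
  into three pieces around letter \<open>j\<close> exhibits the two factors that link it to its neighbours.
  The adjoint gates multiply these links by their own conjugates times \<open>sqrt d\<close>, and
  \<open>\<bar>H\<^sub>a\<^sub>b\<bar>\<^sup>2 = 1 / d\<close> turns each of them into the constant \<open>1 / sqrt d\<close>.
\<close>

lemma finite_words: "finite (words d m)"
proof -
  have "words d m = {as. set as \<subseteq> {..<d} \<and> length as = m}"
    by (auto simp: words_def)
  then show ?thesis
    by (simp add: finite_lists_length_eq)
qed

lemma word_index_append:
  "word_index d (us @ vs) = word_index d us * d ^ length vs + word_index d vs"
  by (induction us) (simp_all add: power_add algebra_simps)

text \<open>By \<open>label_word_index\<close>, every letter can be read back off the index as a
  digit in base \<open>d\<close>.\<close>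

lemma word_index_inj_on: "inj_on (word_index d) (words d m)"
proof (rule inj_onI)
  fix as bs
  assume as: "as \<in> words d m" and bs: "bs \<in> words d m"
    and eq: "word_index d as = word_index d bs"
  have "as ! k = bs ! k" if "k < m" for k
    using label_word_index[OF as, of "Suc k"] label_word_index[OF bs, of "Suc k"] that eq by simp
  then show "as = bs"
    using as bs by (auto simp: words_def intro: nth_equalityI)
qed

text \<open>Base-\<open>d\<close> expansion: the quotient by \<open>d ^ m\<close> is the leading
  letter and the remainder encodes the rest. This lets two vectors be compared at word indices
  only.\<close>

lemma ex_word_index:
  assumes "x < d ^ m"
  shows "\<exists>as\<in>words d m. word_index d as = x"
  using assms
proof (induction m arbitrary: x)
  case 0
  then show ?case by (auto simp: words_def)
next
  case (Suc m)
  \<comment> \<open>For \<open>d = 0\<close> the bound \<open>x < d ^ Suc m\<close> would read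
    \<open>x < 0\<close>.\<close>
  have "d ^ m > 0"
    using Suc.prems by (cases "d = 0") auto
  then obtain as where as: "as \<in> words d m" "word_index d as = x mod d ^ m"
    using Suc.IH[of "x mod d ^ m"] by auto
  have "x div d ^ m < d"
    using Suc.prems by (simp add: less_mult_imp_div_less)
  with as have "x div d ^ m # as \<in> words d (Suc m)" "word_index d (x div d ^ m # as) = x"
    by (auto simp: words_def mult.commute)
  then show ?case by blast
qed

text \<open>Distinct words give distinct basis vectors, so only the summand of \<open>bs\<close>
  survives.\<close>

lemma finsum_ket_index:
  assumes "bs \<in> words d m"
  shows "finsum_vec TYPE(complex) (d ^ m) (\<lambda>as. f as \<cdot>\<^sub>v ket d as) (words d m) $ word_index d bs = f bs"
proof -
  note w = word_index_less[OF assms]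
  have "finsum_vec TYPE(complex) (d ^ m) (\<lambda>as. f as \<cdot>\<^sub>v ket d as) (words d m) $ word_index d bs
      = (\<Sum>as\<in>words d m. (f as \<cdot>\<^sub>v ket d as) $ word_index d bs)"
    by (rule index_finsum_vec[OF finite_words w]) (auto simp: ket_eq_unit_vec)
  also have "\<dots> = (\<Sum>as\<in>words d m. if as = bs then f as else 0)"
  proof (rule sum.cong[OF refl])
    fix as
    assume as: "as \<in> words d m"
    have "word_index d bs = word_index d as \<longleftrightarrow> as = bs"
      using inj_onD[OF word_index_inj_on _ as assms] by metis
    then show "(f as \<cdot>\<^sub>v ket d as) $ word_index d bs = (if as = bs then f as else 0)"
      using w by (simp add: ket_eq_unit_vec[OF as] unit_vec_def)
  qed
  also have "\<dots> = f bs"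
    using assms by (simp add: finite_words)
  finally show ?thesis .
qed

text \<open>The amplitude of a word in the cluster chain. Taking the length from the word itself
  lets pieces of a word be weighed directly; a single letter has weight 1, the empty
  product.\<close>

definition chain_weight :: "complex mat \<Rightarrow> nat list \<Rightarrow> complex" where
  "chain_weight H as = (\<Prod>k<length as - 1. cnj (H $$ (as ! k, as ! Suc k)))"

text \<open>Exactly one neighbouring pair straddles the cut, namely the last letter of
  \<open>us\<close> and the first of \<open>vs\<close>.\<close>

lemma chain_weight_append:
  assumes "us \<noteq> []" "vs \<noteq> []"
  shows "chain_weight H (us @ vs)
    = chain_weight H us * cnj (H $$ (last us, hd vs)) * chain_weight H vs"
  using assms(1)
proof (induction us rule: list_nonempty_induct)
  case (single x)
  then show ?case
    using assms(2) by (cases vs) (simp_all add: chain_weight_def prod.lessThan_Suc_shift del: prod.lessThan_Suc)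
next
  case (cons x us)
  \<comment> \<open>The induction removes letters at the front, so the product must be peeled at its
    first factor, not at its last.\<close>
  then show ?case
    by (cases us) (simp_all add: chain_weight_def prod.lessThan_Suc_shift mult_ac
        del: prod.lessThan_Suc)
qed

lemma cluster_chain_carrier: "cluster_chain d H m \<in> carrier_vec (d ^ m)"
  unfolding cluster_chain_def
  by (rule finsum_vec_closed) (auto simp: ket_eq_unit_vec)

lemma cluster_chain_index:
  assumes "as \<in> words d m"
  shows "cluster_chain d H m $ word_index d as = chain_weight H as"
  using finsum_ket_index[OF assms] assms by (simp add: cluster_chain_def chain_weight_def words_def)

lemma ket_sum_carrier: "ket_sum d \<in> carrier_vec d"
  unfolding ket_sum_def by (rule finsum_vec_closed) auto

lemma ket_sum_index:
  assumes "a < d"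
  shows "ket_sum d $ a = 1"
  unfolding ket_sum_def using assms
  by (subst index_finsum_vec) (auto simp: unit_vec_def)

lemma tensor_vec_carrier:
  assumes "u \<in> carrier_vec k" "v \<in> carrier_vec l"
  shows "u \<otimes>\<^sub>v v \<in> carrier_vec (k * l)"
  by (rule carrier_vecI) (simp add: tensor_vec_def carrier_vecD[OF assms(1)] carrier_vecD[OF assms(2)])

text \<open>Since \<open>y < l\<close>, division of \<open>x * l + y\<close> by \<open>l\<close>
  returns quotient \<open>x\<close> and remainder \<open>y\<close>.\<close>

lemma tensor_vec_index:
  assumes "u \<in> carrier_vec k" "v \<in> carrier_vec l" "x < k" "y < l"
  shows "(u \<otimes>\<^sub>v v) $ (x * l + y) = u $ x * v $ y"
proof -
  have "x * l + y < Suc x * l"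
    using assms(4) by simp
  also have "\<dots> \<le> k * l"
    using assms(3) by (intro mult_right_mono) auto
  finally show ?thesis
    using assms by (simp add: tensor_vec_def)
qed

lemma mat_adjoint_mat_diag: "mat_adjoint (mat_diag m f) = mat_diag m (\<lambda>x. cnj (f x))"
  by (rule eq_matI) (auto simp: mat_adjoint_def mat_diag_def mat_of_rows_index)

lemma mat_diag_mult_vec_index:
  fixes f :: "nat \<Rightarrow> 'a :: semiring_0"
  assumes "v \<in> carrier_vec m" "x < m"
  shows "(mat_diag m f *\<^sub>v v) $ x = f x * v $ x"
proof -
  have "(mat_diag m f *\<^sub>v v) $ x = (\<Sum>y = 0..<m. (if x = y then f y else 0) * v $ y)"
    using assms by (simp add: mat_diag_def scalar_prod_def)
  also have "\<dots> = (\<Sum>y = 0..<m. if x = y then f y * v $ y else 0)"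
    by (rule sum.cong) auto
  also have "\<dots> = f x * v $ x"
    using assms(2) by simp
  finally show ?thesis .
qed

lemma adjoint_gate_Z_carrier: "mat_adjoint (gate_Z d H n i j) \<in> carrier_mat (d ^ n) (d ^ n)"
  by (simp add: gate_Z_def mat_adjoint_mat_diag)

text \<open>The adjoint of a diagonal matrix conjugates its diagonal, which cancels the conjugation
  built into \<open>gate_Z\<close>.\<close>

lemma adjoint_gate_Z_index:
  assumes "as \<in> words d n" "1 \<le> i" "i \<le> n" "1 \<le> j" "j \<le> n" "v \<in> carrier_vec (d ^ n)"
  shows "(mat_adjoint (gate_Z d H n i j) *\<^sub>v v) $ word_index d as
    = complex_of_real (sqrt (real d)) * H $$ (as ! (i - 1), as ! (j - 1)) * v $ word_index d as"
  using assms label_word_index[OF assms(1)] word_index_less[OF assms(1)]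
  by (simp add: gate_Z_def mat_adjoint_mat_diag mat_diag_mult_vec_index)

text \<open>Row \<open>a\<close> of a unitary matrix has norm 1, and its \<open>d\<close> entries
  contribute equally to the squared norm.\<close>

lemma hadamard_mat_mult_cnj:
  assumes "hadamard_mat d H" "a < d" "b < d"
  shows "of_nat d * (H $$ (a, b) * cnj (H $$ (a, b))) = 1"
proof -
  have H: "H \<in> carrier_mat d d" and HH: "H * mat_adjoint H = 1\<^sub>m d"
    using assms(1) by (auto simp: hadamard_mat_def unitary_mat_def)
  have "1 = (H * mat_adjoint H) $$ (a, a)"
    using assms(2) by (simp add: HH)
  also have "\<dots> = (\<Sum>k = 0..<d. H $$ (a, k) * cnj (H $$ (a, k)))"
    using H assms(2) by (auto simp: scalar_prod_def mat_adjoint_def mat_of_rows_index)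
  also have "\<dots> = (\<Sum>k = 0..<d. H $$ (a, b) * cnj (H $$ (a, b)))"
  proof (rule sum.cong[OF refl])
    fix k
    assume "k \<in> {0..<d}"
    then have "cmod (H $$ (a, k)) = cmod (H $$ (a, b))"
      using assms unfolding hadamard_mat_def by (meson atLeastLessThan_iff)
    then show "H $$ (a, k) * cnj (H $$ (a, k)) = H $$ (a, b) * cnj (H $$ (a, b))"
      by (simp flip: complex_norm_square)
  qed
  finally show ?thesis by simp
qed

theorem mainTheorem5:
  fixes d n j :: nat and H :: "complex mat"
  assumes "d \<ge> 1" and "n \<ge> 3" and "1 < j" and "j < n"
    and "hadamard_mat d H" and "transpose_mat H = H"
  shows "\<exists>c :: complex. c \<noteq> 0 \<and>
    mat_adjoint (gate_Z d H n j (j + 1)) *\<^sub>v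
      (mat_adjoint (gate_Z d H n (j - 1) j) *\<^sub>v cluster_chain d H n)
    = c \<cdot>\<^sub>v (cluster_chain d H (j - 1) \<otimes>\<^sub>v ket_sum d \<otimes>\<^sub>v cluster_chain d H (n - j))"
proof (intro exI conjI)
  let ?s = "complex_of_real (sqrt (real d))"
  let ?v = "mat_adjoint (gate_Z d H n (j - 1) j) *\<^sub>v cluster_chain d H n"
  let ?l = "mat_adjoint (gate_Z d H n j (j + 1)) *\<^sub>v ?v"
  let ?t = "ket_sum d \<otimes>\<^sub>v cluster_chain d H (n - j)"
  let ?r = "cluster_chain d H (j - 1) \<otimes>\<^sub>v ?t"
  \<comment> \<open>The scalar is \<open>1 / d\<close>: the two gates contribute
    \<open>sqrt d\<close> each, and the two cancelled links \<open>1 / d\<close> each.\<close>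
  show "1 / of_nat d \<noteq> (0 :: complex)"
    using assms(1) by simp
  have v: "?v \<in> carrier_vec (d ^ n)"
    by (rule mult_mat_vec_carrier[OF adjoint_gate_Z_carrier cluster_chain_carrier])
  have l: "?l \<in> carrier_vec (d ^ n)"
    by (rule mult_mat_vec_carrier[OF adjoint_gate_Z_carrier v])
  \<comment> \<open>The tensor product associates to the right, so qudit \<open>j\<close> is grouped
    with the right-hand chain.\<close>
  have t: "?t \<in> carrier_vec (d ^ Suc (n - j))"
    using tensor_vec_carrier[OF ket_sum_carrier cluster_chain_carrier] by simp
  have "(j - 1) + Suc (n - j) = n"
    using assms(3,4) by simp
  then have "d ^ n = d ^ (j - 1) * d ^ Suc (n - j)"
    by (simp only: power_add[symmetric])
  then have r: "?r \<in> carrier_vec (d ^ n)"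
    using tensor_vec_carrier[OF cluster_chain_carrier t] by simp
  show "?l = (1 / of_nat d) \<cdot>\<^sub>v ?r"
  proof (rule eq_vecI)
    fix x
    assume "x < dim_vec ((1 / of_nat d) \<cdot>\<^sub>v ?r)"
    then have x: "x < d ^ n"
      using r by simp
    then obtain as where as: "as \<in> words d n" and xas: "word_index d as = x"
      using ex_word_index by blast
    define us where "us = take (j - 1) as"
    define a where "a = as ! (j - 1)"
    define vs where "vs = drop j as"
    have len: "length as = n"
      using as by (simp add: words_def)
    have as_eq: "as = us @ a # vs"
      using assms(3,4) len id_take_nth_drop[of "j - 1" as] by (simp add: us_def a_def vs_def)
    have lu: "length us = j - 1" and lv: "length vs = n - j"
      using assms(3,4) len by (simp_all add: us_def vs_def)
    have us: "us \<in> words d (j - 1)" and vs: "vs \<in> words d (n - j)" and a: "a < d"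
      using as lu lv by (auto simp: as_eq words_def)
    \<comment> \<open>Here \<open>1 < j < n\<close> enters: qudit \<open>j\<close> has a neighbour
      on both sides.\<close>
    have ne: "us \<noteq> []" "vs \<noteq> []"
      using assms(3,4) lu lv by auto
    \<comment> \<open>With positions counted from 0, qudits \<open>j - 1\<close>, \<open>j\<close>
      and \<open>j + 1\<close> carry the letters at \<open>j - 2\<close>, \<open>j - 1\<close> and
      \<open>j\<close>.\<close>
    have nth: "as ! (j - 2) = last us" "as ! (j - 1) = a" "as ! j = hd vs"
      using assms(3) ne lu by (auto simp: as_eq nth_append last_conv_nth hd_conv_nth nth_Cons'
          numeral_2_eq_2)
    have bounds: "last us < d" "hd vs < d"
      using us vs ne by (auto simp: words_def subset_iff)
    \<comment> \<open>Two cuts, before and after \<open>a\<close>, isolate the two links; the piece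
      \<open>[a]\<close> between them has weight 1.\<close>
    have "chain_weight H as = chain_weight H us * cnj (H $$ (last us, a))
        * (cnj (H $$ (a, hd vs)) * chain_weight H vs)"
      using chain_weight_append[of us "a # vs" H] chain_weight_append[of "[a]" vs H] ne
      by (simp add: as_eq chain_weight_def)
    then have "?l $ x = (?s * ?s) * (H $$ (last us, a) * cnj (H $$ (last us, a)))
        * (H $$ (a, hd vs) * cnj (H $$ (a, hd vs))) * (chain_weight H us * chain_weight H vs)"
      using adjoint_gate_Z_index[OF as, of j "j + 1" ?v H]
        adjoint_gate_Z_index[OF as, of "j - 1" j "cluster_chain d H n" H]
        cluster_chain_index[OF as, of H] cluster_chain_carrier v assms(3,4) nth
      by (simp add: xas numeral_2_eq_2)
    also have "?s * ?s = of_nat d"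
      by (simp flip: of_real_mult)
    \<comment> \<open>The factor \<open>d\<close> from the gates absorbs the first link, and the
      second link leaves the constant \<open>1 / d\<close>.\<close>
    also have "of_nat d * (H $$ (last us, a) * cnj (H $$ (last us, a))) = 1"
      using hadamard_mat_mult_cnj[OF assms(5) bounds(1) a] .
    also have "H $$ (a, hd vs) * cnj (H $$ (a, hd vs)) = 1 / of_nat d"
      using hadamard_mat_mult_cnj[OF assms(5) a bounds(2)] assms(1)
      by (simp add: field_simps)
    finally have "?l $ x = 1 / of_nat d * (chain_weight H us * chain_weight H vs)"
      by simp
    moreover have "?r $ x = chain_weight H us * chain_weight H vs"
    proof -
      have av: "a # vs \<in> words d (Suc (n - j))"
        using a vs by (auto simp: words_def)
      have "?t $ word_index d (a # vs) = chain_weight H vs"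
        using tensor_vec_index[OF ket_sum_carrier cluster_chain_carrier a word_index_less[OF vs]]
        by (simp add: lv ket_sum_index[OF a] cluster_chain_index[OF vs])
      \<comment> \<open>Only the cut before \<open>a\<close> is made here, matching the outer tensor
        product of \<open>?r\<close>.\<close>
      moreover have "x = word_index d us * d ^ Suc (n - j) + word_index d (a # vs)"
        using word_index_append[of d us "a # vs"] by (simp add: lv as_eq flip: xas)
      ultimately show ?thesis
        using tensor_vec_index[OF cluster_chain_carrier t word_index_less[OF us] word_index_less[OF av]]
        by (simp only: cluster_chain_index[OF us])
    qed
    ultimately show "?l $ x = ((1 / of_nat d) \<cdot>\<^sub>v ?r) $ x"
      using r x by simp
  qed (simp only: carrier_vecD[OF l] carrier_vecD[OF r] index_smult_vec)
qed

end
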